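(* Let $q$ be a prime power, $m$ a positive integer, $t\ge 2$ an integer, and let $f:\mathbb{F}_q^m\to\mathbb{F}_q$ be the polynomial function $f(\mathbf{x})=\sum_{j=1}^t a_jg_j(\mathbf{x})$, where $a_j\in\mathbb{F}_q^*$ and the $g_j(\mathbf{x})$ are monomials in $x_1,\dots,x_m$. If (1) the sets $s(g_1),\dots,s(g_t)$ are (pairwise) disjoint, and (2) $\#s(g_j)\ge 3$ for all $1\le j\le t$, then $\mathcal{C}_f$ is a $[q^m-1,m+1]_q$ minimal linear code.
   Context: For a monomial $g(\mathbf{x})=\prod_{i=1}^m x_i^{b_i}$ (with nonnegative integer exponents $b_i$), $s(g)=\{i : 1\le i\le m,\ b_i\neq 0\}$. Write $\mathbf{x}\cdot\mathbf{y}=\sum_i x_iy_i$. For $f:\mathbb{F}_q^m\to\mathbb{F}_q$, $\mathcal{C}_f=\{(uf(\mathbf{x})+\mathbf{v}\cdot\mathbf{x})_{\mathbf{x}\in\mathbb{F}_q^m\setminus\{\mathbf{0}\}} : u\in\mathbb{F}_q,\ \mathbf{v}\in\mathbb{F}_q^m\}\subseteq\mathbb{F}_q^{q^m-1}$. An $[n,k]_q$ linear code is a $k$-dimensional subspace of $\mathbb{F}_q^n$. The support of a vector is the set of its coordinate positions with nonzero entry. A codeword $\mathbf{c}$ of a linear code $\mathcal{C}$ is minimal if every $\mathbf{b}\in\mathcal{C}$ whose support is contained in the support of $\mathbf{c}$ equals $a\mathbf{c}$ for some $a\in\mathbb{F}_q$; the code $\mathcal{C}$ is minimal if all of its codewords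 are minimal. *)

theory Defs
  imports "HOL-Analysis.Cartesian_Space" "HOL-Library.Disjoint_Sets"
begin

text \<open>
  A finite field with \<open>q\<close> elements is a type \<open>'a :: {field, finite}\<close> with \<open>q = CARD('a)\<close>, and
  \<open>m\<close>-dimensional space over it is \<open>'a ^ 'm\<close> with \<open>m = CARD('m)\<close>.  The nonzero vectors
  form a type, so that words with one coordinate for each nonzero vector are again vectors.
\<close>

typedef (overloaded) ('a, 'm) nonzero_vec = "{x :: 'a :: zero_neq_one ^ 'm :: finite. x \<noteq> 0}"
  morphisms vec_of nonzero_vec
proof
  show "(\<chi> i. 1) \<in> {x :: 'a ^ 'm. x \<noteq> 0}"
    by (simp add: vec_eq_iff)
qed

instance nonzero_vec :: ("{zero_neq_one, finite}", finite) finite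
proof
  have "finite (vec_of ` (UNIV :: ('a, 'b) nonzero_vec set))"
    by simp
  then show "finite (UNIV :: ('a, 'b) nonzero_vec set)"
    by (rule finite_imageD) (simp add: inj_on_def vec_of_inject)
qed

definition dot_prod :: "'a :: comm_semiring_1 ^ 'm :: finite \<Rightarrow> 'a ^ 'm \<Rightarrow> 'a" where
  "dot_prod x y = (\<Sum>i\<in>UNIV. x $ i * y $ i)"

text \<open>
  A monomial is given by its exponent vector \<open>b\<close>, since the set of variables occurring in it depends
  on the formal monomial and not only on the function it induces.
\<close>

definition eval_monomial :: "('m :: finite \<Rightarrow> nat) \<Rightarrow> 'a :: comm_semiring_1 ^ 'm \<Rightarrow> 'a" where
  "eval_monomial b x = (\<Prod>i\<in>UNIV. (x $ i) ^ b i)"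

definition monomial_vars :: "('m \<Rightarrow> nat) \<Rightarrow> 'm set" where
  "monomial_vars b = {i. b i \<noteq> 0}"

definition code_of ::
  "('a :: {field, finite} ^ 'm :: finite \<Rightarrow> 'a) \<Rightarrow> ('a ^ ('a, 'm) nonzero_vec) set" where
  "code_of f = {(\<chi> x. u * f (vec_of x) + dot_prod v (vec_of x)) | u v. True}"

definition linear_code :: "nat \<Rightarrow> nat \<Rightarrow> nat \<Rightarrow> ('a :: {field, finite} ^ 'n :: finite) set \<Rightarrow> bool" where
  "linear_code n k q C \<longleftrightarrow> CARD('n) = n \<and> CARD('a) = q \<and> vec.subspace C \<and> vec.dim C = k"

definition supp :: "'a :: zero ^ 'n \<Rightarrow> 'n set" where
  "supp c = {i. c $ i \<noteq> 0}"

definition minimal_codeword :: "('a :: field ^ 'n) set \<Rightarrow> 'a ^ 'n \<Rightarrow> bool" where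
  "minimal_codeword C c \<longleftrightarrow>
     c \<in> C \<and> (\<forall>b\<in>C. supp b \<subseteq> supp c \<longrightarrow> (\<exists>a. b = a *s c))"

definition minimal_code :: "('a :: field ^ 'n) set \<Rightarrow> bool" where
  "minimal_code C \<longleftrightarrow> (\<forall>c\<in>C. minimal_codeword C c)"

end

theory Submission
  imports Defs
begin

text \<open>
  On vectors with at most two nonzero coordinates \<open>f\<close> vanishes, because every monomial involves three
  variables; so an inclusion of supports between the words of \<open>u f + v \<cdot> x\<close> and \<open>u' f + v' \<cdot> x\<close> forces
  \<open>v' = \<lambda> v\<close> already on such vectors. If \<open>v\<^sub>i \<noteq> 0\<close>, some monomial \<open>g\<^sub>j\<close> does not involve \<open>x\<^sub>i\<close>; setting the
  variables of \<open>g\<^sub>j\<close> to 1, all others except \<open>x\<^sub>i\<close> to 0 and leaving \<open>x\<^sub>i\<close> free keeps \<open>f(x) = a\<^sub>j\<close> while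
  \<open>v \<cdot> x\<close> takes every value. The choice \<open>v \<cdot> x = - u a\<^sub>j\<close> then gives \<open>u' = \<lambda> u\<close>.
\<close>

lemma dot_prod_add_right: "dot_prod v (x + y) = dot_prod v x + dot_prod v y"
  by (simp add: dot_prod_def distrib_left sum.distrib)

lemma dot_prod_scale_left: "dot_prod (k *s v) x = k * dot_prod v x"
  by (simp add: dot_prod_def sum_distrib_left mult.assoc)

lemma dot_prod_zero_left [simp]: "dot_prod 0 x = 0"
  by (simp add: dot_prod_def)

lemma dot_prod_axis [simp]: "dot_prod v (axis i k) = v $ i * k"
  by (simp add: dot_prod_def axis_def if_distrib[where f = "\<lambda>z. _ * z"] cong: if_cong)

lemma eval_monomial_eq_0:
  assumes "i \<in> monomial_vars b" "x $ i = 0"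
  shows "eval_monomial b x = 0"
proof -
  have "(x $ i) ^ b i = 0"
    using assms by (simp add: monomial_vars_def zero_power)
  then show ?thesis
    unfolding eval_monomial_def by (intro prod_zero) auto
qed

lemma eval_monomial_eq_1:
  assumes "\<And>i. i \<in> monomial_vars b \<Longrightarrow> x $ i = 1"
  shows "eval_monomial b x = 1"
  unfolding eval_monomial_def
proof (intro prod.neutral ballI)
  fix i show "x $ i ^ b i = 1"
    using assms[of i] by (cases "b i = 0") (auto simp: monomial_vars_def)
qed

lemma card_nonzero_vec:
  "CARD(('a :: {zero_neq_one, finite}, 'm :: finite) nonzero_vec) = CARD('a) ^ CARD('m) - 1"
proof -
  interpret type_definition "vec_of :: ('a, 'm) nonzero_vec \<Rightarrow> _" nonzero_vec "{x. x \<noteq> 0}"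
    by (rule type_definition_nonzero_vec)
  have "CARD(('a, 'm) nonzero_vec) = card (UNIV - {0 :: 'a ^ 'm})"
    unfolding card by (rule arg_cong[where f = card]) auto
  then show ?thesis
    by (simp add: card_Diff_singleton)
qed

text \<open>If \<open>v $ i\<close> is nonzero, the vector with entries \<open>- v $ k\<close> at
  \<open>i\<close> and \<open>v $ i\<close> at \<open>k\<close> is orthogonal to \<open>v\<close>.
  Orthogonality to \<open>w\<close> then says that the 2 by 2 minor of \<open>v\<close> and
  \<open>w\<close> at \<open>i\<close>, \<open>k\<close> vanishes.\<close>

lemma proportional_if_two_coordinate_kernel_subset:
  fixes v w :: "'a :: field ^ 'm :: finite"
  assumes "\<And>i k r s. dot_prod v (axis i r + axis k s) = 0 \<Longrightarrow> dot_prod w (axis i r + axis k s) = 0"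
  obtains l where "w = l *s v"
proof (cases "v = 0")
  case True
  have "w $ i = 0" for i
    using assms[of i 1 i 0] True by (simp add: dot_prod_add_right)
  then show ?thesis
    using that[of 0] by (simp add: vec_eq_iff)
next
  case False
  then obtain i where i: "v $ i \<noteq> 0"
    by (auto simp: vec_eq_iff)
  have "w $ k = w $ i / v $ i * v $ k" for k
    using assms[of i "- v $ k" k "v $ i"] i
    by (simp add: dot_prod_add_right field_simps)
  then have "w = (w $ i / v $ i) *s v"
    unfolding vec_eq_iff vector_smult_component by blast
  then show ?thesis by (rule that)
qed

text \<open>These two properties are all that the coding argument needs to know about
  \<open>f\<close>. In the second, \<alpha> may depend on \<open>v\<close> but not on
  \<open>c\<close>.\<close>

locale two_coordinate_vanishing =
  fixes f :: "'a :: {field, finite} ^ 'm :: finite \<Rightarrow> 'a"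
  assumes vanishes: "f (axis i r + axis k s) = 0"
    and level_set_meets: "v \<noteq> 0 \<Longrightarrow> \<exists>\<alpha>. \<alpha> \<noteq> 0 \<and> (\<forall>c. \<exists>x. f x = \<alpha> \<and> dot_prod v x = c)"
begin

lemma f_0: "f 0 = 0"
proof -
  \<comment> \<open>\<open>undefined\<close> only stands for some index.\<close>
  have "axis undefined 0 + axis undefined 0 = (0 :: 'a ^ 'm)"
    by (simp add: vec_eq_iff axis_def)
  then show ?thesis
    using vanishes[of undefined 0 undefined 0] by simp
qed

lemma ex_nonzero: "\<exists>x. f x \<noteq> 0"
proof -
  have "(1 :: 'a ^ 'm) \<noteq> 0"
    by (simp add: vec_eq_iff)
  from level_set_meets[OF this] show ?thesis by force
qed

text \<open>Words have no coordinate at the origin, but there both forms vanish since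
  \<open>f 0 = 0\<close>, so adding it changes nothing.\<close>

lemma all_nonzero_vec_iff:
  "(\<forall>z :: ('a, 'm) nonzero_vec. u * f (vec_of z) + dot_prod v (vec_of z) = 0
      \<longrightarrow> u' * f (vec_of z) + dot_prod v' (vec_of z) = 0) \<longleftrightarrow>
   (\<forall>x. u * f x + dot_prod v x = 0 \<longrightarrow> u' * f x + dot_prod v' x = 0)" (is "?L \<longleftrightarrow> ?R")
proof (intro iffI allI impI)
  fix x
  assume L: ?L and x: "u * f x + dot_prod v x = 0"
  show "u' * f x + dot_prod v' x = 0"
  proof (cases "x = 0")
    case True
    then show ?thesis by (simp add: f_0 dot_prod_def)
  next
    case False
    then show ?thesis
      using L[rule_format, of "nonzero_vec x"] x by (simp add: nonzero_vec_inverse)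
  qed
qed auto

text \<open>Serves twice: for minimality, and with \<open>u = 0\<close>, \<open>v = 0\<close> for
  the dimension.\<close>

lemma coefficients_proportional:
  assumes incl: "\<And>x. u * f x + dot_prod v x = 0 \<Longrightarrow> u' * f x + dot_prod v' x = 0"
  obtains l where "u' = l * u" "v' = l *s v"
proof -
  have "dot_prod v' (axis i r + axis k s) = 0" if "dot_prod v (axis i r + axis k s) = 0" for i k r s
    using incl[of "axis i r + axis k s"] that by (simp add: vanishes)
  then obtain l where l: "v' = l *s v"
    by (rule proportional_if_two_coordinate_kernel_subset)
  show thesis
  proof (cases "v = 0")
    case True
    show ?thesis
    proof (cases "u = 0")
      case u: True
      obtain x where "f x \<noteq> 0" using ex_nonzero by blast
      \<comment> \<open>The premise of \<open>incl\<close> now holds everywhere, so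
        \<open>u' * f x\<close> vanishes even where \<open>f x\<close> does not.\<close>
      then have "u' = 0" using incl[of x] True l u by simp
      then show ?thesis using that[of 0] True l by simp
    next
      case False
      then show ?thesis using that[of "u' / u"] True l by simp
    qed
  next
    case False
    then obtain \<alpha> where \<alpha>: "\<alpha> \<noteq> 0" "\<And>c. \<exists>x. f x = \<alpha> \<and> dot_prod v x = c"
      using level_set_meets by blast
    \<comment> \<open>This value makes \<open>u * f x + dot_prod v x\<close> zero while
      \<open>f x\<close> is nonzero.\<close>
    obtain x where x: "f x = \<alpha>" "dot_prod v x = - u * \<alpha>"
      using \<alpha>(2) by blast
    have "u' * \<alpha> = (l * u) * \<alpha>"
      using incl[of x] x by (simp add: l dot_prod_scale_left)
    then have "u' = l * u" using \<alpha>(1) by simp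
    then show ?thesis using that l by blast
  qed
qed

lemma minimal_code: "minimal_code (code_of f)"
  unfolding minimal_code_def minimal_codeword_def
proof (intro ballI conjI impI)
  fix c b :: "'a ^ ('a, 'm) nonzero_vec"
  assume "c \<in> code_of f" "b \<in> code_of f" and supp: "supp b \<subseteq> supp c"
  then obtain u v u' v' where
    c: "c = (\<chi> z. u * f (vec_of z) + dot_prod v (vec_of z))" and
    b: "b = (\<chi> z. u' * f (vec_of z) + dot_prod v' (vec_of z))"
    unfolding code_of_def by blast
  \<comment> \<open>Inclusion of supports is reverse inclusion of zero sets.\<close>
  have "\<forall>z :: ('a, 'm) nonzero_vec. u * f (vec_of z) + dot_prod v (vec_of z) = 0
      \<longrightarrow> u' * f (vec_of z) + dot_prod v' (vec_of z) = 0"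
    using supp by (auto simp: supp_def b c subset_iff)
  then have "\<And>x. u * f x + dot_prod v x = 0 \<Longrightarrow> u' * f x + dot_prod v' x = 0"
    unfolding all_nonzero_vec_iff by blast
  then obtain l where "u' = l * u" "v' = l *s v"
    by (rule coefficients_proportional)
  then have "b = l *s c"
    by (simp add: b c vec_eq_iff[where 'b = "('a, 'm) nonzero_vec"] dot_prod_scale_left algebra_simps)
  then show "\<exists>a. b = a *s c" ..
qed

text \<open>Transposed generator matrix: the code is its column space. The index type
  \<open>'m option\<close> supplies the \<open>m + 1\<close> columns, with \<open>None\<close> for
  \<open>f\<close>.\<close>

definition generator :: "'a ^ 'm option ^ ('a, 'm) nonzero_vec" where
  "generator = (\<chi> z k. case k of None \<Rightarrow> f (vec_of z) | Some i \<Rightarrow> vec_of z $ i)"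

lemma generator_mult_nth:
  "(generator *v y) $ z = y $ None * f (vec_of z) + dot_prod (\<chi> i. y $ Some i) (vec_of z)"
  by (simp add: generator_def matrix_vector_mult_def dot_prod_def UNIV_option_conv
      sum.reindex mult.commute)

lemma code_of_eq_range: "code_of f = range ((*v) generator)"
proof (intro equalityI subsetI)
  fix c assume "c \<in> code_of f"
  then obtain u v where "c = (\<chi> z. u * f (vec_of z) + dot_prod v (vec_of z))"
    unfolding code_of_def by blast
  then have "c = generator *v (\<chi> k. case k of None \<Rightarrow> u | Some i \<Rightarrow> v $ i)"
    by (simp add: vec_eq_iff generator_mult_nth)
  then show "c \<in> range ((*v) generator)" by blast
next
  fix c assume "c \<in> range ((*v) generator)"
  then obtain y where "c = generator *v y" by blast
  then have "c = (\<chi> z. y $ None * f (vec_of z) + dot_prod (\<chi> i. y $ Some i) (vec_of z))"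
    by (simp add: vec_eq_iff generator_mult_nth)
  then show "c \<in> code_of f"
    unfolding code_of_def by blast
qed

text \<open>A zero word vanishes wherever the word with zero coefficients does, so its coefficients
  are a multiple of zero.\<close>

lemma inj_generator: "inj ((*v) generator)"
proof -
  have "y = 0" if "generator *v y = 0" for y :: "'a ^ 'm option"
  proof -
    have "\<forall>z :: ('a, 'm) nonzero_vec. 0 * f (vec_of z) + dot_prod 0 (vec_of z) = 0
        \<longrightarrow> y $ None * f (vec_of z) + dot_prod (\<chi> i. y $ Some i) (vec_of z) = 0"
      using that by (simp add: vec_eq_iff generator_mult_nth)
    then have "\<And>x. 0 * f x + dot_prod 0 x = 0
        \<Longrightarrow> y $ None * f x + dot_prod (\<chi> i. y $ Some i) x = 0"
      unfolding all_nonzero_vec_iff by blast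
    then obtain l where "y $ None = l * 0" "(\<chi> i. y $ Some i) = l *s 0"
      by (rule coefficients_proportional)
    then have "y $ k = 0" for k
      by (cases k) (auto simp: vec_eq_iff)
    then show ?thesis by (simp add: vec_eq_iff)
  qed
  then show ?thesis
    using vec.linear_inj_iff_eq_0[OF matrix_vector_mul_linear_gen] by blast
qed

lemma linear_code:
  "linear_code (CARD('a) ^ CARD('m) - 1) (CARD('m) + 1) CARD('a) (code_of f)"
proof -
  have "vec.subspace (code_of f)"
    unfolding code_of_eq_range
    by (rule vec.linear_subspace_image[OF matrix_vector_mul_linear_gen vec.subspace_UNIV])
  moreover have "vec.dim (code_of f) = CARD('m) + 1"
    unfolding code_of_eq_range
    using vec.dim_image_eq[OF matrix_vector_mul_linear_gen, of generator UNIV] inj_generator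
    by (simp add: card_cart_basis card_UNIV_option)
  ultimately show ?thesis
    by (simp add: linear_code_def card_nonzero_vec)
qed

end

theorem theorem7p1:
  fixes t :: nat
    and a :: "nat \<Rightarrow> 'a :: {field, finite}"
    and g :: "nat \<Rightarrow> 'm :: finite \<Rightarrow> nat"
    and f :: "'a ^ 'm \<Rightarrow> 'a"
  assumes "t \<ge> 2"
    and "\<And>j. j \<in> {1..t} \<Longrightarrow> a j \<noteq> 0"
    and "\<And>x. f x = (\<Sum>j = 1..t. a j * eval_monomial (g j) x)"
    and "disjoint_family_on (\<lambda>j. monomial_vars (g j)) {1..t}"
    and "\<And>j. j \<in> {1..t} \<Longrightarrow> card (monomial_vars (g j)) \<ge> 3"
  shows "linear_code (CARD('a) ^ CARD('m) - 1) (CARD('m) + 1) CARD('a) (code_of f)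
    \<and> minimal_code (code_of f)"
proof -
  let ?S = "\<lambda>j. monomial_vars (g j)"
  have third_variable: "\<exists>l\<in>?S j. l \<noteq> i \<and> l \<noteq> k" if "j \<in> {1..t}" for i j k
  proof (rule ccontr)
    assume "\<not> ?thesis"
    then have "?S j \<subseteq> {i, k}" by blast
    then have "card (?S j) \<le> card {i, k}" by (intro card_mono) auto
    also have "\<dots> \<le> 2" by (simp add: card_insert_if)
    finally show False using assms(5)[OF that] by simp
  qed
  interpret two_coordinate_vanishing f
  proof
    fix i k :: 'm and r s :: 'a
    have "eval_monomial (g j) (axis i r + axis k s) = 0" if j: "j \<in> {1..t}" for j
    proof -
      obtain l where "l \<in> ?S j" "l \<noteq> i" "l \<noteq> k" using third_variable[OF j] by blast
      then show ?thesis
        by (intro eval_monomial_eq_0[of l]) (auto simp: axis_def)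
    qed
    then show "f (axis i r + axis k s) = 0"
      by (simp add: assms(3))
  next
    fix v :: "'a ^ 'm"
    assume "v \<noteq> 0"
    then obtain i where i: "v $ i \<noteq> 0" by (auto simp: vec_eq_iff)
    \<comment> \<open>As \<open>t\<close> is at least 2, the disjoint sets \<open>?S 1\<close> and
      \<open>?S 2\<close> both exist, and one of them misses \<open>i\<close>.\<close>
    obtain j where j: "j \<in> {1..t}" "i \<notin> ?S j"
    proof (cases "i \<in> ?S 1")
      case True
      have "?S 1 \<inter> ?S 2 = {}"
        using assms(1,4) by (auto simp: disjoint_family_on_def)
      then show ?thesis using that[of 2] True assms(1) by auto
    next
      case False
      then show ?thesis using that[of 1] assms(1) by auto
    qed
    let ?e = "(\<chi> l. if l \<in> ?S j then 1 else 0) :: 'a ^ 'm"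
    have f_eq: "f (?e + axis i r) = a j" for r
    proof -
      \<comment> \<open>A variable of \<open>g j'\<close> other than \<open>i\<close> lies outside
        \<open>?S j\<close> by disjointness, so it is 0 at this point.\<close>
      have other: "eval_monomial (g j') (?e + axis i r) = 0" if j': "j' \<in> {1..t}" "j' \<noteq> j" for j'
      proof -
        obtain l where l: "l \<in> ?S j'" "l \<noteq> i" using third_variable[OF j'(1)] by blast
        moreover have "l \<notin> ?S j"
          using l(1) disjoint_family_onD[OF assms(4) j(1) j'(1)] j'(2) by blast
        ultimately show ?thesis
          by (intro eval_monomial_eq_0[of l]) (auto simp: axis_def)
      qed
      \<comment> \<open>Since \<open>i\<close> is not in \<open>?S j\<close>, the added axis vector
        leaves the variables of \<open>g j\<close> at 1.\<close>
      have one: "eval_monomial (g j) (?e + axis i r) = 1"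
        using j(2) by (intro eval_monomial_eq_1) (auto simp: axis_def)
      have "f (?e + axis i r) = (\<Sum>j'\<in>{1..t}. if j' = j then a j else 0)"
        unfolding assms(3) by (intro sum.cong) (auto simp: one other)
      then show ?thesis using j(1) by simp
    qed
    have "\<exists>x. f x = a j \<and> dot_prod v x = c" for c
    proof -
      \<comment> \<open>The solution of \<open>dot_prod v ?e + v $ i * r = c\<close> for
        \<open>r\<close>.\<close>
      let ?r = "(c - dot_prod v ?e) / v $ i"
      have "dot_prod v (?e + axis i ?r) = c"
        using i by (simp add: dot_prod_add_right)
      then show ?thesis using f_eq by blast
    qed
    then show "\<exists>\<alpha>. \<alpha> \<noteq> 0 \<and> (\<forall>c. \<exists>x. f x = \<alpha> \<and> dot_prod v x = c)"
      using assms(2)[OF j(1)] by blast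
  qed
  show ?thesis
    using linear_code minimal_code by blast
qed

end
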